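(* Let $\Sigma=\{\sigma_1,\sigma_2,\dots\}$ be an infinite alphabet totally ordered by $\sigma_1<\sigma_2<\cdots$, let $\mathsf A$ be the Manacher array of some string of length $n$, and let $S$ be the lexicographically minimal string over $\Sigma$ whose Manacher array is $\mathsf A$. Then: (1) For every $i\ge3$, the first occurrence of $\sigma_i$ in $S$, at position $m$ say, is preceded by a substring matching the pattern $ZP_{i-2}$ (i.e. some substring $S[t..m-1]$ matches $ZP_{i-2}$). (2) For every $i\ge3$, every later occurrence of $\sigma_i$ in $S$, at position $m$, is either at a palindromically dependent index or is preceded by a substring $S[t..m-1]$ matching $ZP_{i-2}$. (3) The number of distinct symbols occurring in $S$ equals the minimum number of distinct symbols over all strings (over any alphabet) whose Manacher array is $\mathsf A$.
   Context: The Manacher array of $S$ of length $n$: $\mathsf A[2k-1]$ is the largest $r\ge0$ with $1\le k-r$, $k+r\le n$, $S[k-r..k+r]$ a palindrome, and $\mathsf A[2k]$ the largest $r\ge0$ with $1\le k-r+1$, $k+r\le n$, $S[k-r+1..k+r]$ a palindrome. The center of $S[a..b]$ is $(a+b)/2$. An index $m$ of $S$ is palindromically dependent iff there is a palindromic substring $p=S[a..b]$ with center $c_p=(a+b)/2<m\le b$ (so $S[m]$ is forced equal to $S[a+b-m]$); otherwise it is palindromically independent. Palindromic Zimin patterns: a word matches $ZP_1$ if it is a palindrome $P_1$ (possibly empty); a word $W$ matches $ZP_k$ ($k\ge2$) if $W=U P_k U$ where $U$ matches $ZP_{k-1}$ using palindromes $P_1,\dots,P_{k-1}$, and $P_k$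 is a palindrome different from each of $P_1,\dots,P_{k-1}$. *)

theory Defs
  imports Main
begin

text \<open>Strings are lists; positions are 1-based as in the paper:
  the symbol at position m is  S ! (m - 1).
  The infinite ordered alphabet sigma_1 < sigma_2 < ... is modelled by nat,
  with sigma_i = i - 1 (so sigma_1 = 0).\<close>

definition sigma :: "nat \<Rightarrow> nat" where
  "sigma i = i - 1"

definition is_pal :: "'a list \<Rightarrow> bool" where
  "is_pal w \<longleftrightarrow> rev w = w"

text \<open>S[a..b] (1-based, inclusive); empty when b = a - 1.\<close>
definition substr :: "'a list \<Rightarrow> nat \<Rightarrow> nat \<Rightarrow> 'a list" where
  "substr S a b = take (b + 1 - a) (drop (a - 1) S)"

text \<open>Manacher array entries A[2k-1] and A[2k].\<close>
definition man_odd :: "'a list \<Rightarrow> nat \<Rightarrow> nat" where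
  "man_odd S k = (GREATEST r. r + 1 \<le> k \<and> k + r \<le> length S \<and>
                    is_pal (substr S (k - r) (k + r)))"

definition man_even :: "'a list \<Rightarrow> nat \<Rightarrow> nat" where
  "man_even S k = (GREATEST r. r \<le> k \<and> k + r \<le> length S \<and>
                    is_pal (substr S (k + 1 - r) (k + r)))"

text \<open>The Manacher array A[1..2n] as a list: list index j - 1 holds A[j].\<close>
definition manacher :: "'a list \<Rightarrow> nat list" where
  "manacher S = map (\<lambda>j. if odd j then man_odd S ((j + 1) div 2) else man_even S (j div 2))
                    [1..<2 * length S + 1]"

definition pal_dependent :: "'a list \<Rightarrow> nat \<Rightarrow> bool" where
  "pal_dependent S m \<longleftrightarrow> (\<exists>a b. 1 \<le> a \<and> a \<le> b \<and> b \<le> length S \<and>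
       is_pal (substr S a b) \<and> a + b < 2 * m \<and> m \<le> b)"

inductive zp_match :: "nat \<Rightarrow> 'a list list \<Rightarrow> 'a list \<Rightarrow> bool" where
  base: "is_pal P \<Longrightarrow> zp_match 1 [P] P"
| step: "zp_match k Ps U \<Longrightarrow> is_pal P \<Longrightarrow> P \<notin> set Ps \<Longrightarrow>
         zp_match (Suc k) (Ps @ [P]) (U @ P @ U)"

definition matches_ZP :: "nat \<Rightarrow> 'a list \<Rightarrow> bool" where
  "matches_ZP k W \<longleftrightarrow> (\<exists>Ps. zp_match k Ps W)"

definition lex_le :: "nat list \<Rightarrow> nat list \<Rightarrow> bool" where
  "lex_le S T \<longleftrightarrow> S = T \<or>
     (\<exists>i < min (length S) (length T). take i S = take i T \<and> S ! i < T ! i) \<or>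
     (length S < length T \<and> S = take (length S) T)"

end

(* Equal Manacher arrays means equal sets of palindromic segments. At a position p that no
   palindrome ending at p forces, the lexicographically least string S must carry the least
   symbol distinct from every neighbour, i.e. from every symbol immediately left of a
   palindromic suffix of the preceding prefix: a smaller admissible symbol could be placed at p
   and the rest of the string completed, symbol by symbol, with either a forced copy or a fresh
   symbol. So an occurrence of sigma_i at an unforced position has at least i - 1 distinct
   neighbours. The palindromic suffixes at which a new neighbour appears are nested as U P U,
   with U the previous one and P a palindrome starting with the new neighbour; this yields
   ZP_(i-2). For (3), at the first occurrence of the largest symbol of S the equality pattern of
   the neighbours is determined by the palindromic segments, so every string with the same
   Manacher array needs as many distinct symbols as S. *)

theory Submission
  imports Defs
begin

text \<open>Positions are 0-based and segments half-open: pal_seg X i j says that X ! i, ...,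
  X ! (j - 1) read the same backwards, which is S[i+1..j] in the paper's notation.\<close>

definition pal_seg :: "'a list \<Rightarrow> nat \<Rightarrow> nat \<Rightarrow> bool" where
  "pal_seg X i j \<longleftrightarrow> (\<forall>t. i \<le> t \<and> t < j \<longrightarrow> X ! t = X ! (i + j - 1 - t))"

lemma is_pal_iff_nth: "is_pal w \<longleftrightarrow> (\<forall>t < length w. w ! t = w ! (length w - 1 - t))"
proof -
  have "rev w = w \<longleftrightarrow> (\<forall>t<length w. w ! (length w - Suc t) = w ! t)"
    by (simp add: list_eq_iff_nth_eq rev_nth)
  then show ?thesis unfolding is_pal_def by (metis diff_Suc_eq_diff_pred)
qed

lemma is_pal_take_iff:
  "L \<le> length V \<Longrightarrow> is_pal (take L V) \<longleftrightarrow> (\<forall>x<L. V ! x = V ! (L - 1 - x))"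
  unfolding is_pal_iff_nth by (auto simp: min_def)

lemma is_pal_take_drop_iff_pal_seg:
  "is_pal (take j (drop i X)) \<longleftrightarrow> pal_seg X i (min (i + j) (length X))"
proof -
  define M where "M = min (i + j) (length X)"
  have len: "length (take j (drop i X)) = M - i" unfolding M_def by auto
  have w: "take j (drop i X) ! t = X ! (i + t)" if "t < M - i" for t
    using that unfolding M_def by simp
  have "is_pal (take j (drop i X)) \<longleftrightarrow> (\<forall>t < M - i. X ! (i + t) = X ! (i + (M - i - 1 - t)))"
    unfolding is_pal_iff_nth len by (intro all_cong1 imp_cong refl) (simp add: w)
  also have "\<dots> \<longleftrightarrow> pal_seg X i M"
    unfolding pal_seg_def
  proof safe
    fix t assume H: "\<forall>t < M - i. X ! (i + t) = X ! (i + (M - i - 1 - t))" "i \<le> t" "t < M"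
    have "t - i < M - i" using H(2,3) by arith
    then have "X ! (i + (t - i)) = X ! (i + (M - i - 1 - (t - i)))" using H(1) by blast
    moreover have "i + (M - i - 1 - (t - i)) = i + M - 1 - t" "i + (t - i) = t" using H(2,3) by arith+
    ultimately show "X ! t = X ! (i + M - 1 - t)" by simp
  next
    fix t assume H: "\<forall>t. i \<le> t \<and> t < M \<longrightarrow> X ! t = X ! (i + M - 1 - t)" "t < M - i"
    have "i \<le> i + t \<and> i + t < M" using H(2) by arith
    then have "X ! (i + t) = X ! (i + M - 1 - (i + t))" using H(1) by blast
    moreover have "i + (M - i - 1 - t) = i + M - 1 - (i + t)" using H(2) by arith
    ultimately show "X ! (i + t) = X ! (i + (M - i - 1 - t))" by simp
  qed
  finally show ?thesis unfolding M_def .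
qed

lemma is_pal_substr_iff_pal_seg:
  "a \<le> b \<Longrightarrow> b \<le> length X \<Longrightarrow> is_pal (substr X (Suc a) b) \<longleftrightarrow> pal_seg X a b"
  unfolding substr_def using is_pal_take_drop_iff_pal_seg[of "b - a" a X] by (simp add: min_def)

lemma pal_seg_shrink: "pal_seg X a b \<Longrightarrow> a \<le> a' \<Longrightarrow> a' + b' = a + b \<Longrightarrow> pal_seg X a' b'"
  unfolding pal_seg_def by auto

lemma pal_seg_short: "j \<le> Suc i \<Longrightarrow> pal_seg X i j"
  unfolding pal_seg_def
proof (intro allI impI)
  fix t assume "j \<le> Suc i" "i \<le> t \<and> t < j"
  then have "t = i" "i + j - 1 - t = i" by arith+
  then show "X ! t = X ! (i + j - 1 - t)" by simp
qed

lemma pal_seg_peel: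
  assumes "i < j"
  shows "pal_seg X i j \<longleftrightarrow> X ! i = X ! (j - 1) \<and> pal_seg X (Suc i) (j - 1)"
proof -
  have mirror: "Suc i + (j - 1) - 1 - t = i + j - 1 - t" for t using assms by arith
  have outer: "i + j - 1 - i = j - 1" "i + j - 1 - (j - 1) = i" using assms by arith+
  show ?thesis
    unfolding pal_seg_def mirror
  proof (intro iffI conjI allI impI)
    assume "\<forall>t. i \<le> t \<and> t < j \<longrightarrow> X ! t = X ! (i + j - 1 - t)"
    then have "X ! i = X ! (i + j - 1 - i)" using assms by blast
    then show "X ! i = X ! (j - 1)" by (simp only: outer)
  next
    fix t assume "\<forall>t. i \<le> t \<and> t < j \<longrightarrow> X ! t = X ! (i + j - 1 - t)" "Suc i \<le> t \<and> t < j - 1"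
    then show "X ! t = X ! (i + j - 1 - t)" by auto
  next
    fix t assume H: "X ! i = X ! (j - 1) \<and> (\<forall>t. Suc i \<le> t \<and> t < j - 1 \<longrightarrow> X ! t = X ! (i + j - 1 - t))"
      and t: "i \<le> t \<and> t < j"
    consider "t = i" | "t = j - 1" | "Suc i \<le> t \<and> t < j - 1" using t by arith
    then show "X ! t = X ! (i + j - 1 - t)"
    proof cases
      case 1 then show ?thesis using H by (simp only: outer)
    next
      case 2 then show ?thesis using H by (simp only: outer)
    next
      case 3 then show ?thesis using H by blast
    qed
  qed
qed

lemma pal_seg_take: "j \<le> k \<Longrightarrow> pal_seg (take k X) i j \<longleftrightarrow> pal_seg X i j"
proof -
  have "i + j - 1 - t < k" if "j \<le> k" "i \<le> t \<and> t < j" for t using that by arith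
  then show "j \<le> k \<Longrightarrow> ?thesis" unfolding pal_seg_def by (intro all_cong1 imp_cong refl) simp
qed

lemma pal_seg_append: "j \<le> length X \<Longrightarrow> pal_seg (X @ Y) i j \<longleftrightarrow> pal_seg X i j"
  using pal_seg_take[of j "length X" "X @ Y" i] by simp

lemma le_Greatest_iff_downward_closed:
  fixes P :: "nat \<Rightarrow> bool"
  assumes bound: "\<And>r. P r \<Longrightarrow> r \<le> B" and "P 0" and down: "\<And>r r'. P r \<Longrightarrow> r' \<le> r \<Longrightarrow> P r'"
  shows "P r \<longleftrightarrow> r \<le> (GREATEST r. P r)"
proof
  assume "P r" then show "r \<le> (GREATEST r. P r)" using Greatest_le_nat[of P r B] bound by blast
next
  assume "r \<le> (GREATEST r. P r)"
  moreover have "P (GREATEST r. P r)" using GreatestI_nat[of P 0 B] \<open>P 0\<close> bound by blast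
  ultimately show "P r" using down by blast
qed

lemma nth_manacher:
  assumes "1 \<le> q" "q \<le> 2 * length X"
  shows "manacher X ! (q - 1) =
    (if odd q then man_odd X ((q + 1) div 2) else man_even X (q div 2))"
proof -
  have "q - 1 < length [1..<2 * length X + 1]" using assms by simp
  moreover have "[1..<2 * length X + 1] ! (q - 1) = q" using assms by (subst nth_upt) auto
  ultimately show ?thesis unfolding manacher_def by simp
qed

lemma pal_seg_iff_man_odd:
  assumes "r < k" "k + r \<le> length X"
  shows "pal_seg X (k - r - 1) (k + r) \<longleftrightarrow> r \<le> man_odd X k"
proof -
  define P where "P = (\<lambda>r. r + 1 \<le> k \<and> k + r \<le> length X \<and> is_pal (substr X (k - r) (k + r)))"
  have P: "P r' \<longleftrightarrow> r' < k \<and> k + r' \<le> length X \<and> pal_seg X (k - r' - 1) (k + r')" for r'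
  proof -
    have "r' < k \<Longrightarrow> k - r' = Suc (k - r' - 1)" by arith
    then show ?thesis unfolding P_def using is_pal_substr_iff_pal_seg[of "k - r' - 1" "k + r'" X] by auto
  qed
  have "P r \<longleftrightarrow> r \<le> (GREATEST r. P r)"
  proof (rule le_Greatest_iff_downward_closed)
    show "P r' \<Longrightarrow> r' \<le> length X" for r' unfolding P_def by auto
    show "P 0" unfolding P using assms by (auto intro: pal_seg_short)
    show "P r' \<Longrightarrow> r'' \<le> r' \<Longrightarrow> P r''" for r' r'' unfolding P by (auto elim!: pal_seg_shrink)
  qed
  moreover have "man_odd X k = (GREATEST r. P r)" unfolding man_odd_def P_def ..
  ultimately show ?thesis using P assms by simp
qed

lemma pal_seg_iff_man_even:
  assumes "r \<le> k" "k + r \<le> length X"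
  shows "pal_seg X (k - r) (k + r) \<longleftrightarrow> r \<le> man_even X k"
proof -
  define P where "P = (\<lambda>r. r \<le> k \<and> k + r \<le> length X \<and> is_pal (substr X (k + 1 - r) (k + r)))"
  have P: "P r' \<longleftrightarrow> r' \<le> k \<and> k + r' \<le> length X \<and> pal_seg X (k - r') (k + r')" for r'
  proof -
    have "r' \<le> k \<Longrightarrow> k + 1 - r' = Suc (k - r')" by arith
    then show ?thesis unfolding P_def using is_pal_substr_iff_pal_seg[of "k - r'" "k + r'" X] by auto
  qed
  have "P r \<longleftrightarrow> r \<le> (GREATEST r. P r)"
  proof (rule le_Greatest_iff_downward_closed)
    show "P r' \<Longrightarrow> r' \<le> length X" for r' unfolding P_def by auto
    show "P 0" unfolding P using assms by (auto intro: pal_seg_short)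
    show "P r' \<Longrightarrow> r'' \<le> r' \<Longrightarrow> P r''" for r' r'' unfolding P by (auto elim!: pal_seg_shrink)
  qed
  moreover have "man_even X k = (GREATEST r. P r)" unfolding man_even_def P_def ..
  ultimately show ?thesis using P assms by simp
qed

text \<open>The segment [i, j) is S[i+1..j], whose Manacher entry is A[i + j], stored at list
  index i + j - 1.\<close>

lemma pal_seg_iff_manacher:
  assumes ij: "i < j" "j \<le> length X"
  shows "pal_seg X i j \<longleftrightarrow> (j - i) div 2 \<le> manacher X ! (i + j - 1)"
proof -
  define r where "r = (j - i) div 2"
  have q: "1 \<le> i + j" "i + j \<le> 2 * length X" using ij by auto
  show ?thesis
  proof (cases "odd (j - i)")
    case True
    then have "j - i = 2 * r + 1" unfolding r_def by (rule odd_two_times_div_two_succ[symmetric])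
    then have "odd (i + j)" "(i + j + 1) div 2 = i + r + 1" "i + r + 1 - r - 1 = i" "i + r + 1 + r = j"
      using ij by (simp_all add: odd_add) arith+
    then show ?thesis
      using nth_manacher[OF q] pal_seg_iff_man_odd[of r "i + r + 1" X] ij unfolding r_def by simp
  next
    case False
    then have "even (j - i)" by simp
    then have "j - i = 2 * r" unfolding r_def by (rule even_two_times_div_two[symmetric])
    then have "even (i + j)" "(i + j) div 2 = i + r" "i + r - r = i" "i + r + r = j"
      using ij by (simp_all add: odd_add) arith+
    then show ?thesis
      using nth_manacher[OF q] pal_seg_iff_man_even[of r "i + r" X] ij unfolding r_def by simp
  qed
qed

definition pal_equiv :: "'a list \<Rightarrow> 'b list \<Rightarrow> bool" where
  "pal_equiv X Y \<longleftrightarrow> length X = length Y \<and>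
     (\<forall>i j. j \<le> length X \<longrightarrow> (pal_seg X i j \<longleftrightarrow> pal_seg Y i j))"

lemma manacher_eq_iff_pal_equiv: "manacher X = manacher Y \<longleftrightarrow> pal_equiv X Y"
proof
  assume m: "manacher X = manacher Y"
  have l: "length X = length Y" using arg_cong[OF m, of length] unfolding manacher_def by (simp del: upt_Suc)
  show "pal_equiv X Y" unfolding pal_equiv_def
  proof (intro conjI allI impI l)
    fix i j assume "j \<le> length X"
    then show "pal_seg X i j \<longleftrightarrow> pal_seg Y i j"
      using pal_seg_iff_manacher[of i j X] pal_seg_iff_manacher[of i j Y] l m
        pal_seg_short[of j i X] pal_seg_short[of j i Y]
      by (cases "i < j") auto
  qed
next
  assume p: "pal_equiv X Y"
  then have l: "length X = length Y" unfolding pal_equiv_def by simp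
  have "is_pal (substr X a b) \<longleftrightarrow> is_pal (substr Y a b)" for a b
    unfolding substr_def is_pal_take_drop_iff_pal_seg using p l unfolding pal_equiv_def by simp
  then have "man_odd X = man_odd Y" "man_even X = man_even Y"
    unfolding man_odd_def man_even_def l by simp_all
  then show "manacher X = manacher Y" unfolding manacher_def l by simp
qed

lemma pal_equiv_length: "pal_equiv X Y \<Longrightarrow> length X = length Y"
  unfolding pal_equiv_def by simp

lemma pal_equiv_pal_seg: "pal_equiv X Y \<Longrightarrow> j \<le> length X \<Longrightarrow> pal_seg X i j \<longleftrightarrow> pal_seg Y i j"
  unfolding pal_equiv_def by simp

lemma pal_equiv_refl: "pal_equiv X X"
  unfolding pal_equiv_def by simp

lemma pal_equiv_trans: "pal_equiv X Y \<Longrightarrow> pal_equiv Y Z \<Longrightarrow> pal_equiv X Z"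
  unfolding pal_equiv_def by simp

lemma pal_equiv_take: "pal_equiv X Y \<Longrightarrow> pal_equiv (take k X) (take k Y)"
  unfolding pal_equiv_def by (simp add: pal_seg_take)

text \<open>A new last symbol at position p only creates palindromes [i, p], and [i, p] is one iff
  [i+1, p) is one and positions i and p carry equal symbols.\<close>

lemma pal_equiv_snoc:
  assumes eq: "pal_equiv X Z" and len: "length X = p"
    and pairs: "\<forall>i<p. pal_seg X (Suc i) p \<longrightarrow> (X ! i = x \<longleftrightarrow> Z ! i = z)"
  shows "pal_equiv (X @ [x]) (Z @ [z])"
  unfolding pal_equiv_def
proof (intro conjI allI impI)
  have lZ: "length Z = p" using eq len pal_equiv_length by metis
  show "length (X @ [x]) = length (Z @ [z])" using len lZ by simp
  fix i j assume j: "j \<le> length (X @ [x])"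
  show "pal_seg (X @ [x]) i j \<longleftrightarrow> pal_seg (Z @ [z]) i j"
  proof (cases "j \<le> p")
    case True
    then show ?thesis using pal_seg_append len lZ pal_equiv_pal_seg[OF eq] by metis
  next
    case False
    then have jp: "j = Suc p" using j len by simp
    show ?thesis
    proof (cases "i < p")
      case False
      then have "j \<le> Suc i" using jp by simp
      then show ?thesis using pal_seg_short by metis
    next
      case True
      have "pal_seg (X @ [x]) i j \<longleftrightarrow> X ! i = x \<and> pal_seg X (Suc i) p"
        using pal_seg_peel[of i j "X @ [x]"] pal_seg_append[of p X "[x]" "Suc i"] jp True len
        by (simp add: nth_append)
      also have "\<dots> \<longleftrightarrow> Z ! i = z \<and> pal_seg Z (Suc i) p"
        using pairs True pal_equiv_pal_seg[OF eq, of p "Suc i"] len by auto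
      also have "\<dots> \<longleftrightarrow> pal_seg (Z @ [z]) i j"
        using pal_seg_peel[of i j "Z @ [z]"] pal_seg_append[of p Z "[z]" "Suc i"] jp True lZ
        by (simp add: nth_append)
      finally show ?thesis .
    qed
  qed
qed

text \<open>If [i+1, p) and [i'+1, p) are palindromic segments with i < i', the first one reflects
  position i' to e = i + p - i', so X ! i = X ! i' says that [i, e] is a palindrome.\<close>

lemma nth_eq_iff_pal_seg:
  assumes ii: "i < i'" "i' < p" and pals: "pal_seg X (Suc i) p" "pal_seg X (Suc i') p"
  shows "X ! i = X ! i' \<longleftrightarrow> pal_seg X i (i + p - i' + 1)"
proof -
  define e where "e = i + p - i'"
  have reflect: "X ! t = X ! (Suc i + p - 1 - t)" if "Suc i \<le> t" "t < p" for t
    using pals(1) that unfolding pal_seg_def by blast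
  have "X ! i' = X ! e"
    using reflect[of i'] ii unfolding e_def by (simp add: Suc_diff_le less_imp_le_nat)
  moreover have "pal_seg X (Suc i) e"
    unfolding pal_seg_def
  proof (intro allI impI)
    fix t assume t: "Suc i \<le> t \<and> t < e"
    define s where "s = Suc i + e - 1 - t"
    have "Suc i' \<le> Suc i + p - 1 - t \<and> Suc i + p - 1 - t < p" using t ii unfolding e_def by arith
    then have "X ! (Suc i + p - 1 - t) = X ! (Suc i' + p - 1 - (Suc i + p - 1 - t))"
      using pals(2) unfolding pal_seg_def by blast
    also have "Suc i' + p - 1 - (Suc i + p - 1 - t) = Suc i + p - 1 - s"
      unfolding s_def e_def using t ii unfolding e_def by arith
    also have "Suc i \<le> s" "s < p" using t ii unfolding s_def e_def by arith+
    then have "X ! (Suc i + p - 1 - s) = X ! s" using reflect[of s] by simp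
    finally have "X ! (Suc i + p - 1 - t) = X ! s" .
    moreover have "t < p" using t ii unfolding e_def by arith
    ultimately show "X ! t = X ! (Suc i + e - 1 - t)"
      using reflect[of t] t unfolding s_def by simp
  qed
  moreover have "pal_seg X i (e + 1) \<longleftrightarrow> X ! i = X ! e \<and> pal_seg X (Suc i) e"
    using pal_seg_peel[of i "e + 1" X] ii unfolding e_def by simp
  ultimately show ?thesis unfolding e_def by auto
qed

lemma pal_equiv_nth_eq_iff:
  assumes eq: "pal_equiv X Z" and p: "p \<le> length X" and ii: "i < p" "i' < p"
    and pals: "pal_seg X (Suc i) p" "pal_seg X (Suc i') p"
  shows "X ! i = X ! i' \<longleftrightarrow> Z ! i = Z ! i'"
proof -
  have ordered: "X ! a = X ! b \<longleftrightarrow> Z ! a = Z ! b"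
    if "a < b" "b < p" "pal_seg X (Suc a) p" "pal_seg X (Suc b) p" for a b
  proof -
    have "X ! a = X ! b \<longleftrightarrow> pal_seg X a (a + p - b + 1)"
      using nth_eq_iff_pal_seg that by blast
    also have "\<dots> \<longleftrightarrow> pal_seg Z a (a + p - b + 1)"
      using pal_equiv_pal_seg[OF eq] that p by simp
    also have "\<dots> \<longleftrightarrow> Z ! a = Z ! b"
      using nth_eq_iff_pal_seg that pal_equiv_pal_seg[OF eq p] by metis
    finally show ?thesis .
  qed
  show ?thesis
    using ordered[of i i'] ordered[of i' i] ii pals by (cases i i' rule: linorder_cases) auto
qed

text \<open>The new symbol copies an earlier one it must equal, or is fresh (larger than every
  symbol used so far).\<close>

lemma pal_equiv_snoc_exists:
  fixes X :: "nat list" and T :: "'a list"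
  assumes eq: "pal_equiv X (take j T)" and len: "length X = j" and j: "j < length T"
  shows "\<exists>c. pal_equiv (X @ [c]) (take (Suc j) T)"
proof -
  have T: "take (Suc j) T = take j T @ [T ! j]" using j by (simp add: take_Suc_conv_app_nth)
  show ?thesis
  proof (cases "\<exists>i0<j. pal_seg X (Suc i0) j \<and> T ! i0 = T ! j")
    case True
    then obtain i0 where i0: "i0 < j" "pal_seg X (Suc i0) j" "T ! i0 = T ! j" by blast
    have "pal_equiv (X @ [X ! i0]) (take j T @ [T ! j])"
    proof (rule pal_equiv_snoc[OF eq len], intro allI impI)
      fix i assume i: "i < j" "pal_seg X (Suc i) j"
      have "X ! i = X ! i0 \<longleftrightarrow> take j T ! i = take j T ! i0"
        using pal_equiv_nth_eq_iff[OF eq _ i(1) i0(1) i(2) i0(2)] len by simp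
      then show "X ! i = X ! i0 \<longleftrightarrow> take j T ! i = T ! j" using i i0 by simp
    qed
    then show ?thesis using T by auto
  next
    case False
    have "pal_equiv (X @ [Suc (sum_list X)]) (take j T @ [T ! j])"
    proof (rule pal_equiv_snoc[OF eq len], intro allI impI)
      fix i assume i: "i < j" "pal_seg X (Suc i) j"
      have "X ! i \<le> sum_list X" using i len elem_le_sum_list by metis
      moreover have "T ! i \<noteq> T ! j" using False i by blast
      ultimately show "X ! i = Suc (sum_list X) \<longleftrightarrow> take j T ! i = T ! j" using i by simp
    qed
    then show ?thesis using T by auto
  qed
qed

lemma pal_equiv_extend:
  fixes X :: "nat list" and T :: "'a list"
  assumes "pal_equiv X (take (length X) T)" "length X \<le> length T"
  shows "\<exists>Y. pal_equiv (X @ Y) T"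
  using assms
proof (induction "length T - length X" arbitrary: X)
  case 0
  then show ?case by (metis append_Nil2 diff_is_0_eq le_antisym take_all_iff)
next
  case (Suc d)
  have "length X < length T" using Suc.hyps(2) by arith
  then obtain c where "pal_equiv (X @ [c]) (take (length (X @ [c])) T)"
    using pal_equiv_snoc_exists[OF Suc.prems(1) refl] by auto
  moreover have "d = length T - length (X @ [c])" "length (X @ [c]) \<le> length T"
    using Suc.hyps(2) \<open>length X < length T\<close> by simp_all
  ultimately obtain Y where "pal_equiv ((X @ [c]) @ Y) T" using Suc.hyps(1) by blast
  then show ?case by auto
qed

lemma not_lex_le_at_first_difference:
  assumes "length A = length B" "p < length A" "take p A = take p B" "B ! p < A ! p"
  shows "\<not> lex_le A B"
proof
  assume "lex_le A B"
  then consider "A = B" | i where "i < min (length A) (length B)" "take i A = take i B" "A ! i < B ! i"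
    | "length A < length B"
    unfolding lex_le_def by blast
  then show False
  proof cases
    case (2 i)
    then show False
    proof (cases i p rule: linorder_cases)
      case less
      then have "A ! i = B ! i" using assms(3) by (metis nth_take)
      then show False using 2 by simp
    next
      case greater
      then have "A ! p = B ! p" using 2 by (metis nth_take)
      then show False using assms(4) by simp
    qed (use 2 assms in simp)
  qed (use assms in auto)
qed

text \<open>With 0-based positions, pal_forced S p is palindromic dependence of the paper's index
  p + 1; a symbol at an unforced position must differ from all its neighbours.\<close>

definition pal_forced :: "'a list \<Rightarrow> nat \<Rightarrow> bool" where
  "pal_forced X p \<longleftrightarrow> (\<exists>i<p. pal_seg X i (Suc p))"

definition pal_suffix_neighbours :: "'a list \<Rightarrow> nat \<Rightarrow> 'a set" where
  "pal_suffix_neighbours X p = {X ! a | a. a < p \<and> pal_seg X (Suc a) p}"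

lemma nth_in_pal_suffix_neighbours_iff:
  "X ! p \<in> pal_suffix_neighbours X p \<longleftrightarrow> pal_forced X p"
proof -
  have "pal_seg X a (Suc p) \<longleftrightarrow> X ! a = X ! p \<and> pal_seg X (Suc a) p" if "a < p" for a
    using pal_seg_peel[of a "Suc p" X] that by simp
  then show ?thesis unfolding pal_suffix_neighbours_def pal_forced_def by (auto simp: eq_commute)
qed

lemma pal_forced_imp_earlier_occurrence: "pal_forced X p \<Longrightarrow> \<exists>i<p. X ! i = X ! p"
  unfolding pal_forced_def using pal_seg_peel[of _ "Suc p" X] by auto

lemma pal_equiv_replace_unforced:
  assumes p: "p < length X" and "\<not> pal_forced X p" and v: "v \<notin> pal_suffix_neighbours X p"
  shows "pal_equiv (take p X @ [v]) (take (Suc p) X)"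
proof -
  have "pal_equiv (take p X @ [v]) (take p X @ [X ! p])"
  proof (rule pal_equiv_snoc[OF pal_equiv_refl])
    show "length (take p X) = p" using p by simp
  next
    show "\<forall>i<p. pal_seg (take p X) (Suc i) p \<longrightarrow> (take p X ! i = v \<longleftrightarrow> take p X ! i = X ! p)"
    proof (intro allI impI)
      fix i assume i: "i < p" "pal_seg (take p X) (Suc i) p"
      then have "X ! i \<in> pal_suffix_neighbours X p"
        unfolding pal_suffix_neighbours_def using pal_seg_take[of p p X] by auto
      then have "X ! i \<noteq> v" "X ! i \<noteq> X ! p"
        using v \<open>\<not> pal_forced X p\<close> nth_in_pal_suffix_neighbours_iff by metis+
      then show "take p X ! i = v \<longleftrightarrow> take p X ! i = X ! p" using i by simp
    qed
  qed
  then show ?thesis using p by (simp add: take_Suc_conv_app_nth)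
qed

text \<open>Otherwise a smaller symbol that is no neighbour could be put at p and the rest completed
  by pal_equiv_extend, giving a lexicographically smaller string.\<close>

lemma lexmin_smaller_symbols_are_pal_suffix_neighbours:
  fixes T :: "'a list" and S :: "nat list"
  assumes manS: "manacher S = manacher T"
    and lexmin: "\<forall>S' :: nat list. manacher S' = manacher T \<longrightarrow> lex_le S S'"
    and p: "p < length S" and unforced: "\<not> pal_forced S p"
  shows "{..<S ! p} \<subseteq> pal_suffix_neighbours S p"
proof
  fix v assume "v \<in> {..<S ! p}"
  show "v \<in> pal_suffix_neighbours S p"
  proof (rule ccontr)
    assume "v \<notin> pal_suffix_neighbours S p"
    have ST: "pal_equiv S T" using manS manacher_eq_iff_pal_equiv by blast
    then have "pal_equiv (take p S @ [v]) (take (Suc p) T)"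
      using pal_equiv_replace_unforced[OF p unforced \<open>v \<notin> _\<close>] pal_equiv_take pal_equiv_trans
      by blast
    moreover have "Suc p \<le> length T" using p pal_equiv_length[OF ST] by simp
    ultimately obtain Y where Y: "pal_equiv (take p S @ [v] @ Y) T"
      using pal_equiv_extend[of "take p S @ [v]" T] p by auto
    then have "lex_le S (take p S @ [v] @ Y)"
      using lexmin manacher_eq_iff_pal_equiv by blast
    moreover have "\<not> lex_le S (take p S @ [v] @ Y)"
    proof (rule not_lex_le_at_first_difference)
      show "length S = length (take p S @ [v] @ Y)"
        using pal_equiv_length[OF Y] pal_equiv_length[OF ST] by simp
      show "(take p S @ [v] @ Y) ! p < S ! p" using p \<open>v \<in> {..<S ! p}\<close> by (simp add: nth_append)
    qed (use p in simp_all)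
    ultimately show False by contradiction
  qed
qed

lemma card_image_le_if_factors:
  assumes "finite A" and kernel: "\<And>a b. a \<in> A \<Longrightarrow> b \<in> A \<Longrightarrow> g a = g b \<Longrightarrow> f a = f b"
  shows "card (f ` A) \<le> card (g ` A)"
proof -
  have "f ` A = (\<lambda>y. f (inv_into A g y)) ` (g ` A)"
  proof (intro equalityI subsetI)
    fix x assume "x \<in> f ` A"
    then obtain a where a: "a \<in> A" "x = f a" by blast
    then have "f (inv_into A g (g a)) = f a"
      using kernel inv_into_into[of "g a" g A] f_inv_into_f[of "g a" g A] by blast
    then show "x \<in> (\<lambda>y. f (inv_into A g y)) ` (g ` A)" using a by force
  next
    fix x assume "x \<in> (\<lambda>y. f (inv_into A g y)) ` (g ` A)"
    then obtain a where "a \<in> A" "x = f (inv_into A g (g a))" by blast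
    then show "x \<in> f ` A" using inv_into_into[of "g a" g A] by blast
  qed
  then show ?thesis using card_image_le[OF finite_imageI[OF \<open>finite A\<close>]] by metis
qed

lemma pal_suffix_neighbours_image:
  "pal_suffix_neighbours X p = (\<lambda>a. X ! a) ` {a. a < p \<and> pal_seg X (Suc a) p}"
  unfolding pal_suffix_neighbours_def by auto

lemma finite_pal_suffix_neighbours: "finite (pal_suffix_neighbours X p)"
  unfolding pal_suffix_neighbours_image by simp

lemma card_pal_suffix_neighbours_eq:
  assumes eq: "pal_equiv X Y" and p: "p \<le> length X"
  shows "card (pal_suffix_neighbours X p) = card (pal_suffix_neighbours Y p)"
proof -
  define A where "A = {a. a < p \<and> pal_seg X (Suc a) p}"
  have A: "A = {a. a < p \<and> pal_seg Y (Suc a) p}"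
    unfolding A_def using pal_equiv_pal_seg[OF eq p] by simp
  have fin: "finite A" unfolding A_def by simp
  have "X ! a = X ! b \<longleftrightarrow> Y ! a = Y ! b" if "a \<in> A" "b \<in> A" for a b
    using pal_equiv_nth_eq_iff[OF eq p] that unfolding A_def by blast
  then have "card ((\<lambda>a. X ! a) ` A) \<le> card ((\<lambda>a. Y ! a) ` A)"
    and "card ((\<lambda>a. Y ! a) ` A) \<le> card ((\<lambda>a. X ! a) ` A)"
    using card_image_le_if_factors[OF fin] by blast+
  then have "card ((\<lambda>a. X ! a) ` A) = card ((\<lambda>a. Y ! a) ` A)" by (rule le_antisym)
  then show ?thesis unfolding pal_suffix_neighbours_image A_def[symmetric] A[symmetric] .
qed

lemma card_pal_suffix_neighbours_less_card_set:
  assumes eq: "pal_equiv X Y" and p: "p < length X" and unforced: "\<not> pal_forced X p"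
  shows "card (pal_suffix_neighbours X p) < card (set Y)"
proof -
  have "\<not> pal_forced Y p"
    using unforced pal_equiv_pal_seg[OF eq, of "Suc p"] p unfolding pal_forced_def by simp
  then have "Y ! p \<notin> pal_suffix_neighbours Y p" using nth_in_pal_suffix_neighbours_iff by metis
  then have "card (insert (Y ! p) (pal_suffix_neighbours Y p)) = Suc (card (pal_suffix_neighbours Y p))"
    by (rule card_insert_disjoint[OF finite_pal_suffix_neighbours])
  then have "card (pal_suffix_neighbours Y p) < card (insert (Y ! p) (pal_suffix_neighbours Y p))"
    by simp
  also have "\<dots> \<le> card (set Y)"
    using p pal_equiv_length[OF eq] unfolding pal_suffix_neighbours_def
    by (intro card_mono) auto
  finally show ?thesis using card_pal_suffix_neighbours_eq[OF eq] p by simp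
qed

text \<open>Palindromic suffixes of S[0, p) are handled as palindromic prefixes of its reversal V;
  the followers of those prefixes are then the neighbours at p.\<close>

definition pal_prefix :: "'a list \<Rightarrow> nat \<Rightarrow> bool" where
  "pal_prefix V l \<longleftrightarrow> l < length V \<and> is_pal (take l V)"

definition pal_prefix_followers :: "'a list \<Rightarrow> nat \<Rightarrow> 'a set" where
  "pal_prefix_followers V L = (\<lambda>l. V ! l) ` {l. l < L \<and> pal_prefix V l}"

lemma finite_pal_prefix_followers: "finite (pal_prefix_followers V L)"
  unfolding pal_prefix_followers_def by simp

lemma nth_in_pal_prefix_followers: "l < L \<Longrightarrow> pal_prefix V l \<Longrightarrow> V ! l \<in> pal_prefix_followers V L"
  unfolding pal_prefix_followers_def by simp

lemma pal_prefix_followers_0 [simp]: "pal_prefix_followers V 0 = {}"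
  unfolding pal_prefix_followers_def by simp

lemma pal_prefix_followers_Suc:
  "pal_prefix_followers V (Suc L) =
    (if pal_prefix V L then insert (V ! L) (pal_prefix_followers V L) else pal_prefix_followers V L)"
  unfolding pal_prefix_followers_def by (auto simp: less_Suc_eq)

lemma pal_prefix_followers_last_new:
  assumes "pal_prefix_followers V L \<noteq> {}"
  shows "\<exists>L' < L. pal_prefix V L' \<and> V ! L' \<notin> pal_prefix_followers V L' \<and>
    pal_prefix_followers V L = insert (V ! L') (pal_prefix_followers V L')"
  using assms
proof (induction L)
  case (Suc L)
  show ?case
  proof (cases "pal_prefix V L \<and> V ! L \<notin> pal_prefix_followers V L")
    case True
    then show ?thesis by (auto simp: pal_prefix_followers_Suc)
  next
    case False
    then have "pal_prefix_followers V (Suc L) = pal_prefix_followers V L"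
      by (auto simp: pal_prefix_followers_Suc)
    then show ?thesis using Suc by (metis less_SucI)
  qed
qed simp

text \<open>Two overlapping palindromic prefixes produce a period L - L', which reflects the
  follower of the shorter one onto the follower of a still shorter palindromic prefix.\<close>

lemma pal_prefix_overlap:
  assumes pals: "is_pal (take L V)" "is_pal (take L' V)" and ll: "L' < L" "L \<le> 2 * L'" "L \<le> length V"
  shows "is_pal (take (2 * L' - L) V) \<and> V ! (2 * L' - L) = V ! L'"
proof -
  have long: "V ! x = V ! (L - 1 - x)" if "x < L" for x
    using pals(1) ll(3) that is_pal_take_iff[of L V] by blast
  have short: "V ! x = V ! (L' - 1 - x)" if "x < L'" for x
  proof -
    have "L' \<le> length V" using ll by simp
    then show ?thesis using pals(2) that is_pal_take_iff[of L' V] by blast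
  qed
  have period: "V ! x = V ! (x - (L - L'))" if "L - L' \<le> x" "x < L" for x
  proof -
    have "V ! x = V ! (L - 1 - x)" using long that by blast
    also have "\<dots> = V ! (L' - 1 - (L - 1 - x))" using that by (intro short) arith
    also have "L' - 1 - (L - 1 - x) = x - (L - L')" using that ll by arith
    finally show ?thesis .
  qed
  have "V ! x = V ! (2 * L' - L - 1 - x)" if "x < 2 * L' - L" for x
  proof -
    have "V ! x = V ! (L' - 1 - x)" using that ll by (intro short) arith
    also have "\<dots> = V ! (L' - 1 - x - (L - L'))" using that ll by (intro period) arith+
    also have "L' - 1 - x - (L - L') = 2 * L' - L - 1 - x" using that ll by arith
    finally show ?thesis .
  qed
  moreover have "2 * L' - L \<le> length V" using ll by arith
  ultimately have "is_pal (take (2 * L' - L) V)" using is_pal_take_iff by blast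
  moreover have "V ! L' = V ! (L' - (L - L'))" using ll by (intro period) arith+
  moreover have "L' - (L - L') = 2 * L' - L" using ll by arith
  ultimately show ?thesis by simp
qed

lemma pal_prefix_split:
  assumes pals: "is_pal (take L V)" "is_pal (take L' V)" and ll: "2 * L' < L" "L \<le> length V"
  shows "\<exists>P. take L V = take L' V @ P @ take L' V \<and> is_pal P \<and> P \<noteq> [] \<and> hd P = V ! L'"
proof -
  define Q where "Q = take L V"
  define Q' where "Q' = take L' V"
  define P where "P = drop L' (take (L - L') V)"
  have "rev (drop (L - L') Q) = take L' (rev Q)" unfolding Q_def using ll by (simp add: rev_drop)
  also have "\<dots> = Q'" using pals(1) ll unfolding Q_def Q'_def is_pal_def by simp
  finally have "rev (drop (L - L') Q) = rev Q'" using pals(2) unfolding Q'_def is_pal_def by simp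
  then have right: "drop (L - L') Q = Q'" by simp
  have "L' \<le> L - L'" using ll by arith
  then have "take (L - L') Q = take (L - L') V" "take L' (take (L - L') V) = Q'"
    unfolding Q_def Q'_def by (simp_all add: min_def)
  then have left: "take (L - L') Q = Q' @ P" unfolding P_def by (metis append_take_drop_id)
  have split: "Q = Q' @ P @ Q'" using left right append_take_drop_id[of "L - L'" Q] by simp
  have "rev Q = Q' @ rev P @ Q'"
    using split pals(2) unfolding Q'_def is_pal_def by simp
  then have "is_pal P" using pals(1) split unfolding Q_def is_pal_def by simp
  moreover have "L' < L - L'" using ll by arith
  then have "P \<noteq> []" "hd P = V ! L'" unfolding P_def using ll by (simp_all add: hd_drop_conv_nth)
  ultimately show ?thesis using split unfolding Q_def Q'_def by blast
qed

lemma pal_prefix_new_follower_short: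
  assumes L: "pal_prefix V L" and L': "is_pal (take L' V)" "L' < L"
    and new: "V ! L' \<notin> pal_prefix_followers V L'"
  shows "2 * L' < L"
proof (rule ccontr)
  assume "\<not> 2 * L' < L"
  then have "is_pal (take (2 * L' - L) V) \<and> V ! (2 * L' - L) = V ! L'"
    using pal_prefix_overlap[of L V L'] L L' unfolding pal_prefix_def by simp
  moreover have "2 * L' - L < L'" "L' < length V"
    using L L' \<open>\<not> 2 * L' < L\<close> unfolding pal_prefix_def by arith+
  ultimately have "V ! L' \<in> pal_prefix_followers V L'"
    using nth_in_pal_prefix_followers[of "2 * L' - L" L' V] unfolding pal_prefix_def by simp
  then show False using new by contradiction
qed

text \<open>The Zimin pattern is built from the palindromic prefixes at which a new follower
  appears: each such prefix is U P U with U the previous one, and P starts with the new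
  follower, so P differs from the earlier palindromes, which start with older followers.\<close>

lemma zp_match_pal_prefix:
  "pal_prefix V L \<Longrightarrow> pal_prefix_followers V L \<noteq> {} \<Longrightarrow>
    \<exists>Ps. zp_match (card (pal_prefix_followers V L)) Ps (take L V) \<and>
      (\<forall>P\<in>set Ps. P \<noteq> [] \<and> hd P \<in> pal_prefix_followers V L)"
proof (induction L rule: less_induct)
  case (less L)
  obtain L' where L': "L' < L" "pal_prefix V L'" "V ! L' \<notin> pal_prefix_followers V L'"
    and ins: "pal_prefix_followers V L = insert (V ! L') (pal_prefix_followers V L')"
    using pal_prefix_followers_last_new[OF less.prems(2)] by blast
  have card: "card (pal_prefix_followers V L) = Suc (card (pal_prefix_followers V L'))"
    using ins card_insert_disjoint[OF finite_pal_prefix_followers L'(3)] by simp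
  show ?case
  proof (cases "pal_prefix_followers V L' = {}")
    case True
    have "pal_prefix V 0" "0 < L" "L < length V"
      using less.prems(1) L'(1) unfolding pal_prefix_def is_pal_def by auto
    moreover have "hd (take L V) = V ! 0" using \<open>0 < L\<close> \<open>L < length V\<close>
      by (cases V) auto
    ultimately have "take L V \<noteq> []" "hd (take L V) \<in> pal_prefix_followers V L"
      using nth_in_pal_prefix_followers[of 0 L V] by auto
    moreover have "zp_match 1 [take L V] (take L V)"
      using less.prems(1) zp_match.base unfolding pal_prefix_def by blast
    ultimately show ?thesis using card True by auto
  next
    case False
    obtain Ps where Ps: "zp_match (card (pal_prefix_followers V L')) Ps (take L' V)"
      "\<forall>P\<in>set Ps. P \<noteq> [] \<and> hd P \<in> pal_prefix_followers V L'"
      using less.IH[OF L'(1,2) False] by blast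
    have "2 * L' < L"
      using pal_prefix_new_follower_short less.prems(1) L' unfolding pal_prefix_def by blast
    then obtain P where P: "take L V = take L' V @ P @ take L' V" "is_pal P" "P \<noteq> []" "hd P = V ! L'"
      using pal_prefix_split[of L V L'] less.prems(1) L'(2) unfolding pal_prefix_def by auto
    have "P \<notin> set Ps" using Ps(2) P(4) L'(3) by metis
    then have "zp_match (card (pal_prefix_followers V L)) (Ps @ [P]) (take L V)"
      using zp_match.step[OF Ps(1) P(2)] P(1) card by simp
    moreover have "\<forall>Q\<in>set (Ps @ [P]). Q \<noteq> [] \<and> hd Q \<in> pal_prefix_followers V L"
      using Ps(2) P(3,4) ins by auto
    ultimately show ?thesis by blast
  qed
qed

lemma zp_match_is_pal: "zp_match k Ps U \<Longrightarrow> is_pal U"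
  by (induction rule: zp_match.induct) (auto simp: is_pal_def)

lemma zp_match_suffix:
  "zp_match k Ps U \<Longrightarrow> 1 \<le> k' \<Longrightarrow> k' \<le> k \<Longrightarrow> \<exists>q \<le> length U. matches_ZP k' (drop q U)"
proof (induction arbitrary: k' rule: zp_match.induct)
  case (base P)
  then have "matches_ZP k' (drop 0 P)" using zp_match.base unfolding matches_ZP_def by auto
  then show ?case by blast
next
  case (step k Ps U P)
  show ?case
  proof (cases "k' = Suc k")
    case True
    then have "matches_ZP k' (drop 0 (U @ P @ U))"
      using zp_match.step[OF step.hyps] unfolding matches_ZP_def by auto
    then show ?thesis by blast
  next
    case False
    then obtain q where "q \<le> length U" "matches_ZP k' (drop q U)" using step.IH step.prems by force
    then show ?thesis by (intro exI[of _ "length U + length P + q"]) simp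
  qed
qed

lemma suffix_matches_ZP_if_many_followers:
  assumes k: "1 \<le> k" and many: "k < card (pal_prefix_followers (rev W) (length W))"
  shows "\<exists>q \<le> length W. matches_ZP k (drop q W)"
proof -
  define V where "V = rev W"
  define n where "n = length W"
  have ne: "pal_prefix_followers V n \<noteq> {}" using many unfolding V_def n_def by auto
  obtain L' where L': "L' < n" "pal_prefix V L'" "V ! L' \<notin> pal_prefix_followers V L'"
    and ins: "pal_prefix_followers V n = insert (V ! L') (pal_prefix_followers V L')"
    using pal_prefix_followers_last_new[OF ne] by blast
  have "card (pal_prefix_followers V n) = Suc (card (pal_prefix_followers V L'))"
    using ins card_insert_disjoint[OF finite_pal_prefix_followers L'(3)] by simp
  then have kL': "k \<le> card (pal_prefix_followers V L')" using many unfolding V_def n_def by simp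
  then have "pal_prefix_followers V L' \<noteq> {}" using k by auto
  then obtain Ps where Ps: "zp_match (card (pal_prefix_followers V L')) Ps (take L' V)"
    using zp_match_pal_prefix[OF L'(2)] by blast
  obtain q where q: "q \<le> length (take L' V)" "matches_ZP k (drop q (take L' V))"
    using zp_match_suffix[OF Ps k kL'] by blast
  have "take L' V = rev (drop (n - L') W)" unfolding V_def n_def by (simp add: take_rev)
  moreover have "rev (take L' V) = take L' V" using zp_match_is_pal[OF Ps] unfolding is_pal_def .
  ultimately have "take L' V = drop (n - L') W" by simp
  moreover have "q + (n - L') \<le> length W" using q(1) L'(1) unfolding n_def by auto
  ultimately show ?thesis using q(2) by (intro exI[of _ "q + (n - L')"]) (simp add: add.commute)
qed

lemma is_pal_take_rev_take_iff_pal_seg: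
  assumes "l < p" "p \<le> length X"
  shows "is_pal (take l (rev (take p X))) \<longleftrightarrow> pal_seg X (p - l) p"
proof -
  have "take l (rev (take p X)) = rev (take l (drop (p - l) X))"
    using assms by (simp add: take_rev drop_take)
  moreover have "is_pal (rev w) \<longleftrightarrow> is_pal w" for w :: "'a list" unfolding is_pal_def by auto
  ultimately show ?thesis using is_pal_take_drop_iff_pal_seg[of l "p - l" X] assms by simp
qed

lemma pal_suffix_neighbours_eq_followers:
  assumes p: "p \<le> length X"
  shows "pal_suffix_neighbours X p = pal_prefix_followers (rev (take p X)) p"
proof (intro equalityI subsetI)
  fix w assume "w \<in> pal_suffix_neighbours X p"
  then obtain a where a: "a < p" "pal_seg X (Suc a) p" "w = X ! a"
    unfolding pal_suffix_neighbours_def by blast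
  define l where "l = p - 1 - a"
  have l: "l < p" "p - l = Suc a" "p - 1 - l = a" unfolding l_def using a by arith+
  then have "pal_prefix (rev (take p X)) l"
    using is_pal_take_rev_take_iff_pal_seg[OF l(1) p] a p unfolding pal_prefix_def by simp
  moreover have "rev (take p X) ! l = w" using l a p by (simp add: rev_nth)
  ultimately show "w \<in> pal_prefix_followers (rev (take p X)) p"
    using nth_in_pal_prefix_followers[OF l(1)] by metis
next
  fix w assume "w \<in> pal_prefix_followers (rev (take p X)) p"
  then obtain l where l: "l < p" "pal_prefix (rev (take p X)) l" "w = rev (take p X) ! l"
    unfolding pal_prefix_followers_def by blast
  have "p - l = Suc (p - 1 - l)" "p - 1 - l < p" using l(1) by arith+
  moreover have "pal_seg X (p - l) p"
    using is_pal_take_rev_take_iff_pal_seg[OF l(1) p] l(2) unfolding pal_prefix_def by simp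
  moreover have "w = X ! (p - 1 - l)" using l p by (simp add: rev_nth)
  ultimately show "w \<in> pal_suffix_neighbours X p" unfolding pal_suffix_neighbours_def by auto
qed

lemma lexmin_unforced_preceded_by_zimin:
  fixes T :: "'a list" and S :: "nat list"
  assumes manS: "manacher S = manacher T"
    and lexmin: "\<forall>S' :: nat list. manacher S' = manacher T \<longrightarrow> lex_le S S'"
    and p: "p < length S" and unforced: "\<not> pal_forced S p"
    and i: "3 \<le> i" and Sp: "S ! p = sigma i"
  shows "\<exists>t. 1 \<le> t \<and> t \<le> Suc p \<and> matches_ZP (i - 2) (substr S t p)"
proof -
  have "{..<S ! p} \<subseteq> pal_suffix_neighbours S p"
    using lexmin_smaller_symbols_are_pal_suffix_neighbours[OF manS lexmin p unforced] .
  then have "i - 1 \<le> card (pal_suffix_neighbours S p)"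
    using card_mono[OF finite_pal_suffix_neighbours] Sp unfolding sigma_def by fastforce
  moreover have "length (take p S) = p" using p by simp
  ultimately have "i - 2 < card (pal_prefix_followers (rev (take p S)) (length (take p S)))"
    using pal_suffix_neighbours_eq_followers[of p S] p i by simp
  moreover have "1 \<le> i - 2" using i by simp
  ultimately obtain q where q: "q \<le> p" "matches_ZP (i - 2) (drop q (take p S))"
    using suffix_matches_ZP_if_many_followers \<open>length (take p S) = p\<close> by metis
  have "substr S (Suc q) p = drop q (take p S)" unfolding substr_def by (simp add: drop_take)
  then show ?thesis using q p by (intro exI[of _ "Suc q"]) auto
qed

lemma pal_dependent_if_pal_forced:
  assumes "p < length S" "pal_forced S p"
  shows "pal_dependent S (Suc p)"
proof -
  obtain i where "i < p" "pal_seg S i (Suc p)" using assms(2) unfolding pal_forced_def by blast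
  then have "is_pal (substr S (Suc i) (Suc p))"
    using is_pal_substr_iff_pal_seg[of i "Suc p" S] assms(1) by simp
  then show ?thesis unfolding pal_dependent_def using \<open>i < p\<close> assms(1)
    by (intro exI[of _ "Suc i"] exI[of _ "Suc p"]) auto
qed

text \<open>The first occurrence of the largest symbol v of S is unforced, so all of 0, ..., v - 1 are
  neighbours there, and every string with the same Manacher array needs a further symbol.\<close>

lemma lexmin_card_set_le:
  fixes T :: "'a list" and S :: "nat list" and U :: "'b list"
  assumes manS: "manacher S = manacher T"
    and lexmin: "\<forall>S' :: nat list. manacher S' = manacher T \<longrightarrow> lex_le S S'"
    and manU: "manacher U = manacher T"
  shows "card (set S) \<le> card (set U)"
proof (cases "S = []")
  case False
  then have "Max (set S) \<in> set S" by simp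
  then obtain xs ys where S: "S = xs @ Max (set S) # ys" and first: "Max (set S) \<notin> set xs"
    using in_set_conv_decomp_first by metis
  define p where "p = length xs"
  have p: "p < length S" "S ! p = Max (set S)" unfolding p_def by (subst S; simp)+
  have "\<not> pal_forced S p"
  proof
    assume "pal_forced S p"
    then obtain i where "i < p" "S ! i = S ! p" using pal_forced_imp_earlier_occurrence by blast
    then show False using first p(2) unfolding p_def by (metis S nth_append nth_mem)
  qed
  moreover have "pal_equiv S U" using manS manU manacher_eq_iff_pal_equiv by metis
  ultimately have "card (pal_suffix_neighbours S p) < card (set U)"
    using card_pal_suffix_neighbours_less_card_set p(1) by blast
  moreover have "S ! p \<le> card (pal_suffix_neighbours S p)"
    using lexmin_smaller_symbols_are_pal_suffix_neighbours[OF manS lexmin p(1) \<open>\<not> pal_forced S p\<close>]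
      card_mono[OF finite_pal_suffix_neighbours] by fastforce
  moreover have "set S \<subseteq> {..S ! p}" using p(2) by auto
  then have "card (set S) \<le> Suc (S ! p)" using card_mono[of "{..S ! p}" "set S"] by simp
  ultimately show ?thesis by simp
qed simp

theorem theorem5p1:
  fixes T :: "'a list" and S :: "nat list"
  assumes manS: "manacher S = manacher T"
    and lexmin: "\<forall>S' :: nat list. manacher S' = manacher T \<longrightarrow> lex_le S S'"
  shows
    "(\<forall>i\<ge>3. \<forall>m. 1 \<le> m \<and> m \<le> length S \<and> S ! (m - 1) = sigma i \<and>
          (\<forall>m'. 1 \<le> m' \<and> m' < m \<longrightarrow> S ! (m' - 1) \<noteq> sigma i) \<longrightarrow>
          (\<exists>t. 1 \<le> t \<and> t \<le> m \<and> matches_ZP (i - 2) (substr S t (m - 1))))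
   \<and> (\<forall>i\<ge>3. \<forall>m. 1 \<le> m \<and> m \<le> length S \<and> S ! (m - 1) = sigma i \<and>
          (\<exists>m'. 1 \<le> m' \<and> m' < m \<and> S ! (m' - 1) = sigma i) \<longrightarrow>
          pal_dependent S m \<or>
          (\<exists>t. 1 \<le> t \<and> t \<le> m \<and> matches_ZP (i - 2) (substr S t (m - 1))))
   \<and> (\<forall>U :: 'b list. manacher U = manacher T \<longrightarrow> card (set S) \<le> card (set U))"
proof (intro conjI allI impI)
  fix i m
  assume i: "3 \<le> i" and m: "1 \<le> m \<and> m \<le> length S \<and> S ! (m - 1) = sigma i \<and>
    (\<forall>m'. 1 \<le> m' \<and> m' < m \<longrightarrow> S ! (m' - 1) \<noteq> sigma i)"
  then obtain p where p: "m = Suc p" "p < length S" by (cases m) auto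
  have "\<not> pal_forced S p"
  proof
    assume "pal_forced S p"
    then obtain j where "j < p" "S ! j = S ! p" using pal_forced_imp_earlier_occurrence by blast
    moreover have "1 \<le> Suc j \<and> Suc j < m" using p \<open>j < p\<close> by simp
    then have "S ! (Suc j - 1) \<noteq> sigma i" using m by blast
    ultimately show False using m p by simp
  qed
  then show "\<exists>t. 1 \<le> t \<and> t \<le> m \<and> matches_ZP (i - 2) (substr S t (m - 1))"
    using lexmin_unforced_preceded_by_zimin[OF manS lexmin p(2) _ i] m p by simp
next
  fix i m
  assume i: "3 \<le> i" and m: "1 \<le> m \<and> m \<le> length S \<and> S ! (m - 1) = sigma i \<and>
    (\<exists>m'. 1 \<le> m' \<and> m' < m \<and> S ! (m' - 1) = sigma i)"
  then obtain p where p: "m = Suc p" "p < length S" by (cases m) auto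
  show "pal_dependent S m \<or> (\<exists>t. 1 \<le> t \<and> t \<le> m \<and> matches_ZP (i - 2) (substr S t (m - 1)))"
    using pal_dependent_if_pal_forced[OF p(2)] lexmin_unforced_preceded_by_zimin[OF manS lexmin p(2) _ i]
      m p by (cases "pal_forced S p") simp_all
next
  fix U :: "'b list"
  assume "manacher U = manacher T"
  then show "card (set S) \<le> card (set U)" using lexmin_card_set_le[OF manS lexmin] by blast
qed

end
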